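(* Suppose that the adiabatic index $\gamma$ satisfies $1<\gamma\le\frac53$. Then the Riemann invariant $\mathcal R(w,z)$ (defined in the context) satisfies $$\mathcal R(w,z)<0\qquad\forall z>0,\ \forall w>0,$$ which implies that the second eigenvalue $\lambda_2$ and the fourth eigenvalue $\lambda_4$ of the hyperbolic Navier-Stokes equations are genuinely nonlinear near the equilibrium state $\bar{\boldsymbol u}=(1,0,1,0,0)^{\mathrm T}$.
   Context: Let $\tau_1,\tau_2,\kappa,\mu,R,C_{\mathrm v}>0$, $\gamma=1+R/C_{\mathrm v}$, and $$p=R\frac{\theta}{v}-\frac{\tau_1}{2\kappa\theta}q^2-\frac{\tau_2}{2\mu}S^2,\qquad e=C_{\mathrm v}\theta+\frac{\tau_1v}{\kappa\theta}q^2+\frac{\tau_2v}{2\mu}S^2$$ as functions of $(v,\theta,q,S)$; subscripts denote partial derivatives. The hyperbolic Navier-Stokes equations $$v_t-u_x=0,\ u_t+p_x=S_x,\ (e+\tfrac12u^2)_t+(up)_x+q_x=(uS)_x,\ \tau_1q_t+q+\tfrac{\kappa\theta_x}{v}=0,\ \tau_2S_t+S=\tfrac{\mu u_x}{v}$$ take the form $\boldsymbol u_t+\boldsymbol A(\boldsymbol u)\boldsymbol u_x=\boldsymbol g(\boldsymbol u)$ with $\boldsymbol u=(v,u,\theta,q,S)^{\mathrm T}$ and $$\boldsymbol A(\boldsymbol u)=\begin{pmatrix}0&-1&0&0&0\\ p_v&0&p_\theta&p_q&p_S-1\\ 0&\frac{\theta p_\theta}{e_\theta}&-\frac{2q}{\theta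 e_\theta}&\frac1{e_\theta}&0\\ 0&0&\frac{\kappa}{\tau_1v}&0&0\\ 0&-\frac{\mu}{\tau_2v}&0&0&0\end{pmatrix}.$$ Its characteristic polynomial is $\det(\lambda\boldsymbol E-\boldsymbol A)=\lambda\,\Pi(v,\theta,q,S,\lambda)$ ($\boldsymbol E$ the identity matrix), where, with $c_0^2=\frac{\mu(1-p_S)}{\tau_2v}-p_v$, $$\Pi=\lambda^4+\frac{2q}{\theta e_\theta}\lambda^3-\left(c_0^2+\frac{\kappa}{\tau_1ve_\theta}+\frac{\theta p_\theta^2}{e_\theta}\right)\lambda^2-\left(\frac{2q}{\theta e_\theta}c_0^2+\frac{\kappa\theta p_\theta p_q}{\tau_1ve_\theta}\right)\lambda+\frac{\kappa}{\tau_1ve_\theta}c_0^2.$$ Near $\bar{\boldsymbol u}$ the matrix $\boldsymbol A(\boldsymbol u)$ has five real eigenvalues $\lambda_1<\lambda_2<\lambda_3=0<\lambda_4<\lambda_5$. An eigenvalue $\lambda_i$ with right eigenvector $\boldsymbol r_i$ is genuinely nonlinear if $\nabla_{\boldsymbol u}\lambda_i\cdot\boldsymbol r_i\ne0$. Put $w=\frac{\kappa}{\tau_1C_{\mathrm v}R}>0$, $z=\frac{\mu}{\tau_2R}>0$. Let $\lambda_*$ be the value of $\lambda_2$ or $\lambda_4$ at $\bar{\boldsymbol u}$; it satisfies $\lambda_*^2=R\mathcal L$ with $$\mathcal L=\mathcal L(w,z)=\tfrac12\left[(z+w+\gamma)-\sqrt{(z+w+\gamma)^2-4(z+1)w}\right].$$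 A right eigenvector of $\boldsymbol A(\bar{\boldsymbol u})$ for $\lambda_*$ is $$\boldsymbol r_*=\left(R(w-\mathcal L),\,-\lambda_*R(w-\mathcal L),\,(\gamma-1)R\mathcal L,\,R^2w\lambda_*,\,R^2z(w-\mathcal L)\right)^{\mathrm T}.$$ The Riemann invariant is $\mathcal R(w,z):=\frac1{R^3}\nabla_{(v,u,\theta,q,S)}\Pi\cdot\boldsymbol r_*$, where the gradient (at fixed $\lambda$; $\Pi$ does not depend on $u$) is evaluated at $(v,\theta,q,S,\lambda)=(1,1,0,0,\lambda_* )$; it is regarded as a function of $(w,z)$ for fixed $\gamma$. *)

theory Defs
  imports "HOL-Analysis.Analysis"
begin

record hns_params =
  tau1 :: real
  tau2 :: real
  kappa :: real
  mu :: real
  Rgas :: real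
  Cv :: real

definition positive_params :: "hns_params \<Rightarrow> bool" where
  "positive_params P \<longleftrightarrow>
     tau1 P > 0 \<and> tau2 P > 0 \<and> kappa P > 0 \<and> mu P > 0 \<and> Rgas P > 0 \<and> Cv P > 0"

definition adiabatic :: "hns_params \<Rightarrow> real" where
  "adiabatic P = 1 + Rgas P / Cv P"

definition pressure :: "hns_params \<Rightarrow> real \<Rightarrow> real \<Rightarrow> real \<Rightarrow> real \<Rightarrow> real" where
  "pressure P v \<theta> q S =
     Rgas P * \<theta> / v - tau1 P / (2 * kappa P * \<theta>) * q^2 - tau2 P / (2 * mu P) * S^2"

definition energy :: "hns_params \<Rightarrow> real \<Rightarrow> real \<Rightarrow> real \<Rightarrow> real \<Rightarrow> real" where
  "energy P v \<theta> q S =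
     Cv P * \<theta> + tau1 P * v / (kappa P * \<theta>) * q^2 + tau2 P * v / (2 * mu P) * S^2"

definition p_v :: "hns_params \<Rightarrow> real \<Rightarrow> real \<Rightarrow> real \<Rightarrow> real \<Rightarrow> real" where
  "p_v P v \<theta> q S = deriv (\<lambda>x. pressure P x \<theta> q S) v"

definition p_theta :: "hns_params \<Rightarrow> real \<Rightarrow> real \<Rightarrow> real \<Rightarrow> real \<Rightarrow> real" where
  "p_theta P v \<theta> q S = deriv (\<lambda>x. pressure P v x q S) \<theta>"

definition p_q :: "hns_params \<Rightarrow> real \<Rightarrow> real \<Rightarrow> real \<Rightarrow> real \<Rightarrow> real" where
  "p_q P v \<theta> q S = deriv (\<lambda>x. pressure P v \<theta> x S) q"

definition p_S :: "hns_params \<Rightarrow> real \<Rightarrow> real \<Rightarrow> real \<Rightarrow> real \<Rightarrow> real" where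
  "p_S P v \<theta> q S = deriv (\<lambda>x. pressure P v \<theta> q x) S"

definition e_theta :: "hns_params \<Rightarrow> real \<Rightarrow> real \<Rightarrow> real \<Rightarrow> real \<Rightarrow> real" where
  "e_theta P v \<theta> q S = deriv (\<lambda>x. energy P v x q S) \<theta>"

(* A state U :: real^5 has the components (v, u, theta, q, S) = (U$1, U$2, U$3, U$4, U$5).
   In the index type 5 the numeral 5 equals 0; only distinctness of 1, ..., 5 matters. *)

definition ubar :: "real^5" where
  "ubar = vector [1, 0, 1, 0, 0]"

definition hns_matrix :: "hns_params \<Rightarrow> real^5 \<Rightarrow> real^5^5" where
  "hns_matrix P U =
     (let v = U$1; \<theta> = U$3; q = U$4; S = U$5;
          pv = p_v P v \<theta> q S; pth = p_theta P v \<theta> q S;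
          pq = p_q P v \<theta> q S; pS = p_S P v \<theta> q S; eth = e_theta P v \<theta> q S
      in vector
        [vector [0, - 1, 0, 0, 0],
         vector [pv, 0, pth, pq, pS - 1],
         vector [0, \<theta> * pth / eth, - (2 * q / (\<theta> * eth)), 1 / eth, 0],
         vector [0, 0, kappa P / (tau1 P * v), 0, 0],
         vector [0, - (mu P / (tau2 P * v)), 0, 0, 0]])"

definition eigenvalues :: "real^5^5 \<Rightarrow> real set" where
  "eigenvalues M = {l. \<exists>r. r \<noteq> 0 \<and> M *v r = l *s r}"

(* The i-th real eigenvalue in increasing order, i = 1, ..., 5; near ubar there are
   exactly five of them. *)
definition char_speed :: "hns_params \<Rightarrow> nat \<Rightarrow> real^5 \<Rightarrow> real" where
  "char_speed P i U = sorted_list_of_set (eigenvalues (hns_matrix P U)) ! (i - 1)"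

definition c0_sq :: "hns_params \<Rightarrow> real \<Rightarrow> real \<Rightarrow> real \<Rightarrow> real \<Rightarrow> real" where
  "c0_sq P v \<theta> q S =
     mu P * (1 - p_S P v \<theta> q S) / (tau2 P * v) - p_v P v \<theta> q S"

(* det (l E - A) = l * char_quartic *)
definition char_quartic :: "hns_params \<Rightarrow> real^5 \<Rightarrow> real \<Rightarrow> real" where
  "char_quartic P U l =
     (let v = U$1; \<theta> = U$3; q = U$4; S = U$5;
          pth = p_theta P v \<theta> q S; pq = p_q P v \<theta> q S;
          eth = e_theta P v \<theta> q S; c2 = c0_sq P v \<theta> q S
      in l^4 + 2 * q / (\<theta> * eth) * l^3
         - (c2 + kappa P / (tau1 P * v * eth) + \<theta> * pth^2 / eth) * l^2
         - (2 * q / (\<theta> * eth) * c2 + kappa P * \<theta> * pth * pq / (tau1 P * v * eth)) * l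
         + kappa P / (tau1 P * v * eth) * c2)"

definition grad :: "(real^5 \<Rightarrow> real) \<Rightarrow> real^5 \<Rightarrow> real^5" where
  "grad f U = (\<chi> i. frechet_derivative f (at U) (axis i 1))"

(* Differentiability is demanded explicitly because frechet_derivative is arbitrary otherwise. *)
definition genuinely_nonlinear ::
    "(real^5 \<Rightarrow> real^5^5) \<Rightarrow> (real^5 \<Rightarrow> real) \<Rightarrow> real^5 \<Rightarrow> bool" where
  "genuinely_nonlinear A lam U \<longleftrightarrow>
     lam U \<in> eigenvalues (A U) \<and> lam differentiable (at U) \<and>
     (\<forall>r. r \<noteq> 0 \<and> A U *v r = lam U *s r \<longrightarrow> grad lam U \<bullet> r \<noteq> 0)"

definition w_of :: "hns_params \<Rightarrow> real" where
  "w_of P = kappa P / (tau1 P * Cv P * Rgas P)"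

definition z_of :: "hns_params \<Rightarrow> real" where
  "z_of P = mu P / (tau2 P * Rgas P)"

definition calL :: "real \<Rightarrow> real \<Rightarrow> real \<Rightarrow> real" where
  "calL \<gamma> w z = 1/2 * ((z + w + \<gamma>) - sqrt ((z + w + \<gamma>)^2 - 4 * (z + 1) * w))"

definition r_star :: "hns_params \<Rightarrow> real \<Rightarrow> real^5" where
  "r_star P l =
     (let R = Rgas P; \<gamma> = adiabatic P; w = w_of P; z = z_of P; L = calL \<gamma> w z
      in vector [R * (w - L), - (l * R * (w - L)), (\<gamma> - 1) * R * L,
                 R^2 * w * l, R^2 * z * (w - L)])"

definition riemann_at :: "hns_params \<Rightarrow> real \<Rightarrow> real" where
  "riemann_at P l = 1 / (Rgas P)^3 * (grad (\<lambda>U. char_quartic P U l) ubar \<bullet> r_star P l)"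

(* For fixed \<gamma>, the value of riemann_at depends on the parameters only through (w, z), and
   not on the choice of lambda_2 or lambda_4 at ubar; THE expresses the resulting function.
   Every (w, z) with w, z > 0 comes from some positive parameters when \<gamma> > 1. *)
definition riemann_invariant :: "real \<Rightarrow> real \<Rightarrow> real \<Rightarrow> real" where
  "riemann_invariant \<gamma> w z =
     (THE \<rho>. \<forall>P. positive_params P \<and> adiabatic P = \<gamma> \<and> w_of P = w \<and> z_of P = z \<longrightarrow>
        (\<forall>i\<in>{2, 4}. riemann_at P (char_speed P i ubar) = \<rho>))"

end

theory Submission
  imports Defs
begin

text \<open>
The argument has an algebraic part at the equilibrium and a perturbation part around it.

At the equilibrium write \<open>\<delta> = \<gamma> - 1\<close>, \<open>L\<close> for the smaller root of
\<open>L\<^sup>2 - (z + w + \<gamma>) L + (z + 1) w = 0\<close>, \<open>X = w - L\<close>, \<open>Y = \<delta> L\<close> and \<open>y = z + 1 - L\<close>.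
The quadratic equation says exactly \<open>X y = Y\<close>, and \<open>L\<close>, \<open>X\<close>, \<open>y\<close> are positive
(\<open>calL_properties\<close>). Differentiating the quartic and eliminating \<open>w\<close> and \<open>z\<close> through this
relation turns the Riemann invariant into
\<open>- (2 X\<^sup>2 - 3 X Y + 3 Y\<^sup>2 + 2 y Y L)\<close> (\<open>riemann_at_eq\<close>). The first three terms in the bracket
form a positive definite quadratic form, as \<open>3\<^sup>2 < 4 * 2 * 3\<close>, and the last term is positive.

Near the equilibrium the nonzero eigenvalues are the roots of the quartic, and the eigenspace
of a nonzero eigenvalue is the line spanned by a vector that depends continuously on the state
and the eigenvalue (\<open>eigenvectors_iff\<close>). At the equilibrium the quartic has four simple real
roots; sign changes between them survive small perturbations, which locates the second and
fourth eigenvalue (\<open>eventually_char_speeds_near\<close>). By implicit differentiation, the derivative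
of such an eigenvalue along its eigenvector is \<open>- (\<nabla>\<Pi> \<cdot> r) / \<Pi>\<^sub>\<lambda>\<close>. Numerator and denominator are
continuous and do not vanish at the equilibrium, the numerator because it is a multiple of the
Riemann invariant there; hence both stay nonzero in a neighbourhood
(\<open>eventually_genuinely_nonlinear\<close>).
\<close>

section \<open>Continuously differentiable real functions and implicit roots\<close>

text \<open>
Continuity of the derivative is asked for at \<open>x\<close> only. This suffices to keep a directional
derivative that is nonzero at \<open>x\<close> nonzero nearby. The derivative is bundled as a bounded linear
map so that \<open>f' y (h y)\<close> is continuous also when the direction \<open>h y\<close> varies.
\<close>

definition C1_at :: "('a::real_normed_vector \<Rightarrow> real) \<Rightarrow> 'a \<Rightarrow> bool" where
  "C1_at f x \<longleftrightarrow> (\<exists>f'. isCont f' x \<and>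
     (\<forall>\<^sub>F y in nhds x. (f has_derivative blinfun_apply (f' y)) (at y)))"

named_theorems C1_intros

lemma C1_at_const [C1_intros]: "C1_at (\<lambda>_. c) x"
  unfolding C1_at_def by (rule exI[of _ "\<lambda>_. 0"]) (simp add: zero_blinfun.rep_eq)

lemma C1_at_bounded_linear:
  assumes "bounded_linear f"
  shows "C1_at f x"
  unfolding C1_at_def
  using bounded_linear_imp_has_derivative[OF assms]
  by (intro exI[of _ "\<lambda>_. Blinfun f"]) (simp add: bounded_linear_Blinfun_apply[OF assms])

lemma C1_at_imp_isCont:
  assumes "C1_at f x"
  shows "isCont f x"
proof -
  from assms obtain f' where "\<forall>\<^sub>F y in nhds x. (f has_derivative blinfun_apply (f' y)) (at y)"
    unfolding C1_at_def by blast
  then have "(f has_derivative blinfun_apply (f' x)) (at x)"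
    by (rule eventually_nhds_x_imp_x)
  then show ?thesis by (rule has_derivative_continuous)
qed

lemma C1_at_add [C1_intros]:
  assumes "C1_at f x" and "C1_at g x"
  shows "C1_at (\<lambda>y. f y + g y) x"
proof -
  obtain f' g' where c: "isCont f' x" "isCont g' x"
    and d: "\<forall>\<^sub>F y in nhds x. (f has_derivative blinfun_apply (f' y)) (at y)"
           "\<forall>\<^sub>F y in nhds x. (g has_derivative blinfun_apply (g' y)) (at y)"
    using assms unfolding C1_at_def by blast
  have "\<forall>\<^sub>F y in nhds x. ((\<lambda>y. f y + g y) has_derivative blinfun_apply (f' y + g' y)) (at y)"
    using d by eventually_elim (auto simp: plus_blinfun.rep_eq intro!: derivative_eq_intros)
  moreover have "isCont (\<lambda>y. f' y + g' y) x" using c by (intro continuous_intros)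
  ultimately show ?thesis unfolding C1_at_def by blast
qed

lemma C1_at_mult [C1_intros]:
  assumes "C1_at f x" and "C1_at g x"
  shows "C1_at (\<lambda>y. f y * g y) x"
proof -
  obtain f' g' where c: "isCont f' x" "isCont g' x"
    and d: "\<forall>\<^sub>F y in nhds x. (f has_derivative blinfun_apply (f' y)) (at y)"
           "\<forall>\<^sub>F y in nhds x. (g has_derivative blinfun_apply (g' y)) (at y)"
    using assms unfolding C1_at_def by blast
  have "\<forall>\<^sub>F y in nhds x. ((\<lambda>y. f y * g y) has_derivative
          blinfun_apply (g y *\<^sub>R f' y + f y *\<^sub>R g' y)) (at y)"
    using d by eventually_elim
      (auto simp: plus_blinfun.rep_eq scaleR_blinfun.rep_eq algebra_simps
            intro!: derivative_eq_intros)
  moreover have "isCont (\<lambda>y. g y *\<^sub>R f' y + f y *\<^sub>R g' y) x"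
    using c C1_at_imp_isCont[OF assms(1)] C1_at_imp_isCont[OF assms(2)]
    by (intro continuous_intros)
  ultimately show ?thesis unfolding C1_at_def by blast
qed

lemma C1_at_uminus [C1_intros]: "C1_at f x \<Longrightarrow> C1_at (\<lambda>y. - f y) x"
  using C1_at_mult[OF C1_at_const[of "-1"]] by simp

lemma C1_at_diff [C1_intros]: "C1_at f x \<Longrightarrow> C1_at g x \<Longrightarrow> C1_at (\<lambda>y. f y - g y) x"
  using C1_at_add[OF _ C1_at_uminus] by simp

lemma C1_at_power [C1_intros]: "C1_at f x \<Longrightarrow> C1_at (\<lambda>y. f y ^ n) x"
  by (induction n) (auto intro!: C1_at_const C1_at_mult)

lemma C1_at_inverse:
  assumes "C1_at f x" and "f x \<noteq> 0"
  shows "C1_at (\<lambda>y. inverse (f y)) x"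
proof -
  obtain f' where c: "isCont f' x"
    and d: "\<forall>\<^sub>F y in nhds x. (f has_derivative blinfun_apply (f' y)) (at y)"
    using assms unfolding C1_at_def by blast
  note f = C1_at_imp_isCont[OF assms(1)]
  have "\<forall>\<^sub>F y in nhds x. f y \<noteq> 0"
    using tendsto_imp_eventually_ne[OF f[unfolded isCont_def] assms(2)] assms(2)
    by (simp add: eventually_nhds_conv_at)
  with d have "\<forall>\<^sub>F y in nhds x. ((\<lambda>y. inverse (f y)) has_derivative
          blinfun_apply ((- (inverse (f y))\<^sup>2) *\<^sub>R f' y)) (at y)"
    by eventually_elim
      (auto simp: scaleR_blinfun.rep_eq uminus_blinfun.rep_eq power2_eq_square
            intro!: derivative_eq_intros)
  moreover have "isCont (\<lambda>y. (- (inverse (f y))\<^sup>2) *\<^sub>R f' y) x"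
    using c f assms(2) by (intro continuous_intros)
  ultimately show ?thesis unfolding C1_at_def by blast
qed

lemma C1_at_divide [C1_intros]:
  "C1_at f x \<Longrightarrow> C1_at g x \<Longrightarrow> g x \<noteq> 0 \<Longrightarrow> C1_at (\<lambda>y. f y / g y) x"
  using C1_at_mult[OF _ C1_at_inverse] by (simp add: divide_inverse)

lemma C1_at_cong:
  assumes "C1_at f x" and "\<forall>\<^sub>F y in nhds x. f y = g y"
  shows "C1_at g x"
proof -
  obtain f' where c: "isCont f' x"
    and d: "\<forall>\<^sub>F y in nhds x. (f has_derivative blinfun_apply (f' y)) (at y)"
    using assms unfolding C1_at_def by blast
  have "\<forall>\<^sub>F y in nhds x. \<forall>\<^sub>F z in nhds y. f z = g z"
    using assms(2) by (simp add: eventually_eventually)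
  with d have "\<forall>\<^sub>F y in nhds x. (g has_derivative blinfun_apply (f' y)) (at y)"
  proof eventually_elim
    case (elim y)
    then show ?case
      using has_derivative_transform_eventually[of f _ y UNIV g]
      by (auto simp: eventually_nhds_conv_at)
  qed
  with c show ?thesis unfolding C1_at_def by blast
qed

text \<open>
The map \<open>\<Phi> (y, t) = (y, F (y, t))\<close> is injective on the cylinder \<open>A \<times> (a, b)\<close>, since \<open>F\<close> takes
no value twice on a vertical segment by the mean value theorem. The inverse of \<open>\<Phi>\<close> sends
\<open>(y, 0)\<close> to \<open>(y, g y)\<close>, so the inverse function theorem makes \<open>g\<close> differentiable.
\<close>

lemma implicit_root_has_derivative:
  fixes F :: "'a::euclidean_space \<times> real \<Rightarrow> real" and g :: "'a \<Rightarrow> real"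
  assumes "open A" and "x \<in> A"
    and der: "\<And>y t. y \<in> A \<Longrightarrow> t \<in> {a<..<b} \<Longrightarrow> (F has_derivative F' (y, t)) (at (y, t))"
    and nz: "\<And>y t. y \<in> A \<Longrightarrow> t \<in> {a<..<b} \<Longrightarrow> F' (y, t) (0, 1) \<noteq> 0"
    and root: "\<And>y. y \<in> A \<Longrightarrow> g y \<in> {a<..<b} \<and> F (y, g y) = 0"
  shows "(g has_derivative (\<lambda>h. - F' (x, g x) (h, 0) / F' (x, g x) (0, 1))) (at x)"
proof -
  define S where "S = A \<times> {a<..<b}"
  define \<Phi> where "\<Phi> = (\<lambda>X. (fst X, F X))"
  have dF: "(F has_derivative F' X) (at X)" if "X \<in> S" for X
    using that der[of "fst X" "snd X"] by (cases X) (auto simp: S_def)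
  have "open S" unfolding S_def using \<open>open A\<close> by (intro open_Times) auto
  have part: "((\<lambda>s. F (y, s)) has_real_derivative F' (y, t) (0, 1)) (at t)"
    if "y \<in> A" "t \<in> {a<..<b}" for y t
  proof -
    have "((\<lambda>s. F (y, s)) has_derivative (\<lambda>h. F' (y, t) (0, h))) (at t)"
      by (rule has_derivative_compose[where f = "\<lambda>s. (y, s)" and s = UNIV, OF _ der[OF that]])
         (auto intro!: derivative_eq_intros)
    moreover have "(\<lambda>h. F' (y, t) (0, h)) = (*) (F' (y, t) (0, 1))"
    proof
      fix h
      show "F' (y, t) (0, h) = F' (y, t) (0, 1) * h"
        using linear_scale[OF has_derivative_linear[OF der[OF that]], of h "(0, 1)"]
        by (simp add: mult.commute)
    qed
    ultimately show ?thesis unfolding has_field_derivative_def by (rule has_derivative_eq_rhs)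
  qed
  have less_ne: "F (y, s) \<noteq> F (y, t)" if "y \<in> A" "s \<in> {a<..<b}" "t \<in> {a<..<b}" "s < t" for y s t
  proof
    assume eq: "F (y, s) = F (y, t)"
    have slope: "((\<lambda>s. F (y, s)) has_real_derivative F' (y, u) (0, 1)) (at u)"
      if "s \<le> u" "u \<le> t" for u
      using part that \<open>y \<in> A\<close> \<open>s \<in> {a<..<b}\<close> \<open>t \<in> {a<..<b}\<close> by simp
    obtain u where "s < u" "u < t" "F (y, t) - F (y, s) = (t - s) * F' (y, u) (0, 1)"
      using MVT2[OF \<open>s < t\<close> slope] by blast
    then show False using eq nz[of y u] that by auto
  qed
  have inj: "inj_on \<Phi> S"
  proof (rule inj_onI)
    fix X Y assume "X \<in> S" "Y \<in> S" "\<Phi> X = \<Phi> Y"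
    then show "X = Y"
      using less_ne[of "fst X" "snd X" "snd Y"] less_ne[of "fst X" "snd Y" "snd X"]
      by (cases X; cases Y) (force simp: S_def \<Phi>_def)
  qed
  have xS: "(x, g x) \<in> S" using root[OF \<open>x \<in> A\<close>] \<open>x \<in> A\<close> by (simp add: S_def)
  let ?c = "F' (x, g x) (0, 1)"
  have c: "?c \<noteq> 0" using nz xS by (auto simp: S_def)
  have lin: "linear (F' (x, g x))" by (rule has_derivative_linear[OF dF[OF xS]])
  have split: "F' (x, g x) (h, k) = F' (x, g x) (h, 0) + k * ?c" for h k
    using linear_add[OF lin, of "(h, 0)" "(0, k)"] linear_scale[OF lin, of k "(0, 1)"] by simp
  have d\<Phi>: "(\<Phi> has_derivative (\<lambda>H. (fst H, F' X H))) (at X)" if "X \<in> S" for X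
    unfolding \<Phi>_def
    by (rule has_derivative_Pair[OF has_derivative_fst[OF has_derivative_ident] dF[OF that]])
  have "(inv_into S \<Phi> has_derivative (\<lambda>H. (fst H, (snd H - F' (x, g x) (fst H, 0)) / ?c)))
          (at (\<Phi> (x, g x)))"
  proof (rule has_derivative_inverse_strong[OF \<open>open S\<close> xS _ _ d\<Phi>[OF xS]])
    show "continuous_on S \<Phi>"
      by (rule has_derivative_continuous_on) (rule has_derivative_at_withinI[OF d\<Phi>])
    show "inv_into S \<Phi> (\<Phi> X) = X" if "X \<in> S" for X
      using inj that by (rule inv_into_f_f)
    show "(\<lambda>H. (fst H, F' (x, g x) H)) \<circ> (\<lambda>H. (fst H, (snd H - F' (x, g x) (fst H, 0)) / ?c)) = id"
    proof
      fix H
      show "((\<lambda>H. (fst H, F' (x, g x) H)) \<circ>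
          (\<lambda>H. (fst H, (snd H - F' (x, g x) (fst H, 0)) / ?c))) H = id H"
        using c split[of "fst H" "(snd H - F' (x, g x) (fst H, 0)) / ?c"]
        by (simp add: prod_eq_iff)
    qed
  qed
  then have inv: "(inv_into S \<Phi> has_derivative (\<lambda>H. (fst H, (snd H - F' (x, g x) (fst H, 0)) / ?c)))
          (at (x, 0))"
    using root[OF \<open>x \<in> A\<close>] by (simp add: \<Phi>_def)
  have pair: "((\<lambda>y. (y, 0 :: real)) has_derivative (\<lambda>h. (h, 0))) (at x)"
    by (rule has_derivative_Pair[OF has_derivative_ident has_derivative_const])
  have "((\<lambda>y. snd (inv_into S \<Phi> (y, 0))) has_derivative
          (\<lambda>h. - F' (x, g x) (h, 0) / ?c)) (at x)"
    using has_derivative_snd[OF has_derivative_compose[OF pair inv]] by simp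
  moreover have "snd (inv_into S \<Phi> (y, 0)) = g y" if "y \<in> A" for y
    using inv_into_f_f[OF inj, of "(y, g y)"] root[OF that] that by (simp add: \<Phi>_def S_def)
  ultimately show ?thesis
    using has_derivative_transform_within_open[OF _ \<open>open A\<close> \<open>x \<in> A\<close>] by blast
qed

text \<open>
The gradient is only ever used through directional derivatives; this removes it in favour of the
Frechet derivative.
\<close>

lemma grad_inner:
  assumes "(f has_derivative f') (at U)"
  shows "grad f U \<bullet> r = f' r"
proof -
  have lin: "linear f'" by (rule has_derivative_linear[OF assms])
  have "f' r = f' (\<Sum>i\<in>UNIV. r $ i *\<^sub>R axis i 1)"
    using basis_expansion[of r] by (simp add: scalar_mult_eq_scaleR)
  also have "\<dots> = (\<Sum>i\<in>UNIV. r $ i * f' (axis i 1))"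
    by (simp add: linear_sum[OF lin] linear_scale[OF lin])
  finally show ?thesis
    unfolding grad_def frechet_derivative_at[OF assms, symmetric] inner_vec_def
    by (simp add: mult.commute)
qed

section \<open>Five-dimensional vectors\<close>

lemma exhaust_5:
  fixes x :: 5
  shows "x = 1 \<or> x = 2 \<or> x = 3 \<or> x = 4 \<or> x = 5"
proof (induct x)
  case (of_int z)
  then have "z = 0 \<or> z = 1 \<or> z = 2 \<or> z = 3 \<or> z = 4" by fastforce
  then show ?case by auto
qed

lemma forall_5: "(\<forall>i::5. P i) \<longleftrightarrow> P 1 \<and> P 2 \<and> P 3 \<and> P 4 \<and> P 5"
  by (metis exhaust_5)

lemma UNIV_5: "UNIV = {1, 2, 3, 4, 5::5}"
  using exhaust_5 by auto

lemma sum_5: "sum f (UNIV::5 set) = f 1 + f 2 + f 3 + f 4 + f 5"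
  unfolding UNIV_5 by (simp add: ac_simps)

lemma vector_5 [simp]:
  "(vector [a, b, c, d, e] :: 'a::zero^5) $ 1 = a"
  "(vector [a, b, c, d, e] :: 'a::zero^5) $ 2 = b"
  "(vector [a, b, c, d, e] :: 'a::zero^5) $ 3 = c"
  "(vector [a, b, c, d, e] :: 'a::zero^5) $ 4 = d"
  "(vector [a, b, c, d, e] :: 'a::zero^5) $ 5 = e"
  unfolding vector_def by auto

lemma vec_eq_iff_5:
  "(x :: 'a^5) = y \<longleftrightarrow> x $ 1 = y $ 1 \<and> x $ 2 = y $ 2 \<and> x $ 3 = y $ 3 \<and> x $ 4 = y $ 4 \<and> x $ 5 = y $ 5"
  by (simp add: vec_eq_iff forall_5)

lemma continuous_vector_5:
  fixes a b c d e :: "'a::t2_space \<Rightarrow> real"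
  assumes "continuous F a" "continuous F b" "continuous F c" "continuous F d" "continuous F e"
  shows "continuous F (\<lambda>x. vector [a x, b x, c x, d x, e x] :: real^5)"
  unfolding continuous_def
proof (rule vec_tendstoI)
  fix i :: 5
  show "((\<lambda>x. (vector [a x, b x, c x, d x, e x] :: real^5) $ i) \<longlongrightarrow>
      (vector [a (netlimit F), b (netlimit F), c (netlimit F), d (netlimit F), e (netlimit F)] :: real^5) $ i) F"
    using assms exhaust_5[of i] by (auto simp: continuous_def)
qed

section \<open>Eigenvalues and eigenvectors of the flux matrix\<close>

lemma p_v_eq:
  assumes "v \<noteq> 0"
  shows "p_v P v \<theta> q S = - (Rgas P * \<theta> / v\<^sup>2)"
  unfolding p_v_def pressure_def using assms
  by (intro DERIV_imp_deriv) (auto intro!: derivative_eq_intros simp: power2_eq_square)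

lemma p_theta_eq:
  assumes "positive_params P" "v \<noteq> 0" "\<theta> \<noteq> 0"
  shows "p_theta P v \<theta> q S = Rgas P / v + tau1 P * q\<^sup>2 / (2 * kappa P * \<theta>\<^sup>2)"
  unfolding p_theta_def pressure_def using assms
  by (intro DERIV_imp_deriv,
      (auto intro!: derivative_eq_intros simp: power2_eq_square positive_params_def)[1],
      simp add: mult_ac)

lemma p_q_eq:
  assumes "positive_params P" "\<theta> \<noteq> 0"
  shows "p_q P v \<theta> q S = - (tau1 P * q / (kappa P * \<theta>))"
  unfolding p_q_def pressure_def using assms
  by (intro DERIV_imp_deriv) (auto intro!: derivative_eq_intros simp: positive_params_def)

lemma p_S_eq:
  assumes "positive_params P"
  shows "p_S P v \<theta> q S = - (tau2 P * S / mu P)"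
  unfolding p_S_def pressure_def using assms
  by (intro DERIV_imp_deriv) (auto intro!: derivative_eq_intros simp: positive_params_def)

lemma e_theta_eq:
  assumes "positive_params P" "\<theta> \<noteq> 0"
  shows "e_theta P v \<theta> q S = Cv P - tau1 P * v * q\<^sup>2 / (kappa P * \<theta>\<^sup>2)"
  unfolding e_theta_def energy_def using assms
  by (intro DERIV_imp_deriv,
      (auto intro!: derivative_eq_intros simp: power2_eq_square positive_params_def)[1],
      simp add: mult_ac)

text \<open>
On these states the entries of the flux matrix are regular and \<open>p_theta\<close> is positive.
\<close>

definition admissible :: "hns_params \<Rightarrow> real^5 \<Rightarrow> bool" where
  "admissible P U \<longleftrightarrow> U$1 > 0 \<and> U$3 > 0 \<and> e_theta P (U$1) (U$3) (U$4) (U$5) > 0"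

text \<open>
The third row of the eigenvector equations, multiplied by \<open>l\<close> and with the fourth component
eliminated, reads \<open>l T r\<^sub>2 = J r\<^sub>3\<close>. The choice \<open>r\<^sub>2 = l J\<close>, \<open>r\<^sub>3 = l\<^sup>2 T\<close> solves it without division by \<open>J\<close>
or \<open>l\<close>, and is nonzero because \<open>T\<close> is.
\<close>

definition eigendirection :: "hns_params \<Rightarrow> real^5 \<Rightarrow> real \<Rightarrow> real^5" where
  "eigendirection P U l =
     (let v = U$1; \<theta> = U$3; q = U$4; S = U$5;
          eth = e_theta P v \<theta> q S; k = kappa P / (tau1 P * v);
          J = l\<^sup>2 + 2 * q / (\<theta> * eth) * l - k / eth; T = \<theta> * p_theta P v \<theta> q S / eth
      in vector [- J, l * J, l\<^sup>2 * T, k * (l * T), - (mu P / (tau2 P * v) * J)])"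

text \<open>
For \<open>l \<noteq> 0\<close> the first, fourth and fifth equation determine \<open>r1\<close>, \<open>r4\<close>, \<open>r5\<close> from \<open>r2\<close> and
\<open>r3\<close>. What remains is a homogeneous system of two equations in \<open>r2\<close>, \<open>r3\<close>, whose determinant
is, up to sign, the quartic; as \<open>l T \<noteq> 0\<close>, its coefficient matrix is never zero, so the solution
space is at most a line.
\<close>

lemma reduced_eigen_system:
  fixes l :: real
  assumes "l \<noteq> 0" "T \<noteq> 0"
    and J: "J = l\<^sup>2 + b * l - k * f"
  shows "(r1 \<noteq> 0 \<or> r2 \<noteq> 0 \<or> r3 \<noteq> 0 \<or> r4 \<noteq> 0 \<or> r5 \<noteq> 0) \<and>
      - r2 = l * r1 \<and> pv * r1 + pth * r3 + pq * r4 + (pS - 1) * r5 = l * r2 \<and>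
      T * r2 - b * r3 + f * r4 = l * r3 \<and> k * r3 = l * r4 \<and> - (m * r2) = l * r5 \<longleftrightarrow>
    (l\<^sup>2 - (m * (1 - pS) - pv)) * J - l * T * (l * pth + pq * k) = 0 \<and>
      (\<exists>s. s \<noteq> 0 \<and> r1 = s * - J \<and> r2 = s * (l * J) \<and> r3 = s * (l\<^sup>2 * T) \<and>
        r4 = s * (k * (l * T)) \<and> r5 = s * - (m * J))"
    (is "?nz \<and> ?sys \<longleftrightarrow> ?quartic = 0 \<and> (\<exists>s. ?dir s)")
proof
  assume "?nz \<and> ?sys"
  then have nz: ?nz and e: "- r2 = l * r1" "pv * r1 + pth * r3 + pq * r4 + (pS - 1) * r5 = l * r2"
      "T * r2 - b * r3 + f * r4 = l * r3" "k * r3 = l * r4" "- (m * r2) = l * r5"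
    by auto
  have A: "l * T * r2 = J * r3"
  proof -
    have "l * T * r2 = l * (T * r2 - b * r3 + f * r4) + l * b * r3 - f * (l * r4)"
      by (simp add: algebra_simps)
    also have "\<dots> = J * r3"
      unfolding e(3) e(4)[symmetric] J by (simp add: algebra_simps power2_eq_square)
    finally show ?thesis .
  qed
  have B: "(l\<^sup>2 - (m * (1 - pS) - pv)) * r2 = (l * pth + pq * k) * r3"
  proof -
    have "l * (l * r2) = pv * (l * r1) + l * pth * r3 + pq * (l * r4) + (pS - 1) * (l * r5)"
      unfolding e(2)[symmetric] by (simp add: algebra_simps)
    then show ?thesis
      unfolding e(1)[symmetric] e(4)[symmetric] e(5)[symmetric]
      by (simp add: algebra_simps power2_eq_square)
  qed
  have r3: "r3 \<noteq> 0"
  proof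
    assume "r3 = 0"
    then have "r2 = 0" using A assms(1,2) by simp
    with \<open>r3 = 0\<close> nz e assms(1) show False by auto
  qed
  have "?quartic * r3 = (l\<^sup>2 - (m * (1 - pS) - pv)) * (J * r3) - l * T * ((l * pth + pq * k) * r3)"
    by (simp add: algebra_simps)
  also have "\<dots> = 0" unfolding A[symmetric] B[symmetric] by (simp add: algebra_simps)
  finally have "?quartic = 0" using r3 by simp
  moreover define s where "s = r3 / (l\<^sup>2 * T)"
  have s: "r3 = s * (l\<^sup>2 * T)" "s \<noteq> 0" using r3 assms(1,2) by (simp_all add: s_def)
  have "l * T * r2 = l * T * (s * (l * J))" unfolding A s(1) by (simp add: power2_eq_square algebra_simps)
  then have r2: "r2 = s * (l * J)" using assms(1,2) by simp
  have "l * r1 = l * (s * - J)" "l * r4 = l * (s * (k * (l * T)))" "l * r5 = l * (s * - (m * J))"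
    unfolding e(1)[symmetric] e(4)[symmetric] e(5)[symmetric] r2 s(1)
    by (simp_all add: power2_eq_square algebra_simps)
  then have "?dir s" using s r2 assms(1) by (simp only: mult_left_cancel simp_thms)
  ultimately show "?quartic = 0 \<and> (\<exists>s. ?dir s)" by blast
next
  assume "?quartic = 0 \<and> (\<exists>s. ?dir s)"
  then obtain s where q: "?quartic = 0" and s: "?dir s" by blast
  then have r: "r1 = s * - J" "r2 = s * (l * J)" "r3 = s * (l\<^sup>2 * T)"
      "r4 = s * (k * (l * T))" "r5 = s * - (m * J)" by auto
  have nz: "r3 \<noteq> 0" using s assms(1,2) by simp
  have "pv * r1 + pth * r3 + pq * r4 + (pS - 1) * r5 - l * r2 = - s * ?quartic"
    unfolding r by (simp add: power2_eq_square algebra_simps)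
  with q have "pv * r1 + pth * r3 + pq * r4 + (pS - 1) * r5 = l * r2" by simp
  moreover have "- r2 = l * r1" "k * r3 = l * r4" "- (m * r2) = l * r5"
    unfolding r by (simp_all add: power2_eq_square algebra_simps)
  moreover have "T * r2 - b * r3 + f * r4 = l * r3"
    unfolding r J by (simp add: power2_eq_square algebra_simps)
  ultimately show "?nz \<and> ?sys" using nz by blast
qed

lemma eigenvectors_iff:
  assumes P: "positive_params P" and U: "admissible P U" and l: "l \<noteq> 0"
  shows "r \<noteq> 0 \<and> hns_matrix P U *v r = l *s r \<longleftrightarrow>
    char_quartic P U l = 0 \<and> (\<exists>s. s \<noteq> 0 \<and> r = s *s eigendirection P U l)"
proof -
  define v \<theta> q S where "v = U$1" and "\<theta> = U$3" and "q = U$4" and "S = U$5"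
  note U_defs = v_def[symmetric] \<theta>_def[symmetric] q_def[symmetric] S_def[symmetric]
  define eth where "eth = e_theta P v \<theta> q S"
  define pth where "pth = p_theta P v \<theta> q S"
  have pos: "v > 0" "\<theta> > 0" "eth > 0"
    using U unfolding admissible_def U_defs eth_def by auto
  have "pth > 0"
  proof -
    have "Rgas P / v > 0" "tau1 P * q\<^sup>2 / (2 * kappa P * \<theta>\<^sup>2) \<ge> 0"
      using P pos by (auto simp: positive_params_def)
    then show ?thesis unfolding pth_def using P pos by (simp add: p_theta_eq)
  qed
  define T where "T = \<theta> * pth / eth"
  define b where "b = 2 * q / (\<theta> * eth)"
  define k where "k = kappa P / (tau1 P * v)"
  define m where "m = mu P / (tau2 P * v)"
  define J where "J = l\<^sup>2 + b * l - k * (1 / eth)"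
  have T: "T \<noteq> 0" using pos \<open>pth > 0\<close> by (simp add: T_def)
  have quartic: "char_quartic P U l = (l\<^sup>2 - (m * (1 - p_S P v \<theta> q S) - p_v P v \<theta> q S)) * J
      - l * T * (l * pth + p_q P v \<theta> q S * k)"
  proof -
    define c where "c = m * (1 - p_S P v \<theta> q S) - p_v P v \<theta> q S"
    have c: "c0_sq P v \<theta> q S = c" by (simp add: c0_sq_def c_def m_def)
    have K: "kappa P / (tau1 P * v * eth) = k * (1 / eth)" by (simp add: k_def)
    have K2: "kappa P * \<theta> * pth * p_q P v \<theta> q S / (tau1 P * v * eth) = T * p_q P v \<theta> q S * k"
      by (simp add: k_def T_def mult_ac)
    have T2: "\<theta> * pth\<^sup>2 / eth = T * pth" by (simp add: T_def power2_eq_square)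
    show ?thesis
      unfolding char_quartic_def Let_def U_defs eth_def[symmetric] pth_def[symmetric] c
        c_def[symmetric] b_def[symmetric] K K2 T2 J_def
      by (simp add: power2_eq_square power3_eq_cube power4_eq_xxxx algebra_simps)
  qed
  have sys: "hns_matrix P U *v r = l *s r \<longleftrightarrow>
      - r$2 = l * r$1 \<and>
      p_v P v \<theta> q S * r$1 + pth * r$3 + p_q P v \<theta> q S * r$4 + (p_S P v \<theta> q S - 1) * r$5 = l * r$2 \<and>
      T * r$2 - b * r$3 + 1 / eth * r$4 = l * r$3 \<and> k * r$3 = l * r$4 \<and> - (m * r$2) = l * r$5"
    unfolding hns_matrix_def Let_def U_defs eth_def[symmetric] pth_def[symmetric] T_def b_def k_def m_def
    by (simp add: vec_eq_iff_5 matrix_vector_mult_def sum_5)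
  have dir: "eigendirection P U l = vector [- J, l * J, l\<^sup>2 * T, k * (l * T), - (m * J)]"
    unfolding eigendirection_def Let_def U_defs eth_def[symmetric] pth_def[symmetric] J_def b_def k_def m_def T_def
    by simp
  show ?thesis
    unfolding sys quartic dir
    using reduced_eigen_system[OF l T J_def, of "r$1" "r$2" "r$3" "r$4" "r$5"]
    by (simp add: vec_eq_iff_5)
qed

text \<open>
For \<open>l = 0\<close> the rows force \<open>r2 = r3 = r4 = 0\<close> and leave a single equation between \<open>r1\<close> and \<open>r5\<close>.
\<close>

lemma zero_eigenvalue:
  assumes P: "positive_params P" and U: "admissible P U"
  shows "0 \<in> eigenvalues (hns_matrix P U)"
proof -
  define r :: "real^5" where
    "r = vector [1 - p_S P (U$1) (U$3) (U$4) (U$5), 0, 0, 0, p_v P (U$1) (U$3) (U$4) (U$5)]"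
  have "p_v P (U$1) (U$3) (U$4) (U$5) \<noteq> 0"
    using P U by (simp add: p_v_eq admissible_def positive_params_def)
  then have "r \<noteq> 0" by (simp add: vec_eq_iff_5 r_def)
  moreover have "hns_matrix P U *v r = 0 *s r"
    by (simp add: vec_eq_iff_5 matrix_vector_mult_def sum_5 hns_matrix_def Let_def r_def algebra_simps)
  ultimately show ?thesis unfolding eigenvalues_def by blast
qed

lemma eigenvalues_eq:
  assumes P: "positive_params P" and U: "admissible P U"
  shows "eigenvalues (hns_matrix P U) = insert 0 {l. l \<noteq> 0 \<and> char_quartic P U l = 0}"
proof (rule set_eqI)
  fix l
  show "l \<in> eigenvalues (hns_matrix P U) \<longleftrightarrow> l \<in> insert 0 {l. l \<noteq> 0 \<and> char_quartic P U l = 0}"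
  proof (cases "l = 0")
    case True
    then show ?thesis using zero_eigenvalue[OF assms] by simp
  next
    case False
    have "l \<in> eigenvalues (hns_matrix P U) \<longleftrightarrow>
        (\<exists>r. char_quartic P U l = 0 \<and> (\<exists>s. s \<noteq> 0 \<and> r = s *s eigendirection P U l))"
      unfolding eigenvalues_def mem_Collect_eq eigenvectors_iff[OF assms False] ..
    then show ?thesis using False by (auto intro: exI[of _ 1])
  qed
qed

text \<open>
A monic quartic has at most four roots, so the four given ones together with \<open>0\<close> are all the
eigenvalues, already listed in increasing order.
\<close>

lemma char_speed_eqI:
  assumes P: "positive_params P" and U: "admissible P U"
    and roots: "char_quartic P U l1 = 0" "char_quartic P U l2 = 0"
      "char_quartic P U l4 = 0" "char_quartic P U l5 = 0"
    and less: "l1 < l2" "l2 < 0" "0 < l4" "l4 < l5"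
  shows "char_speed P 2 U = l2" and "char_speed P 4 U = l4"
proof -
  have "\<exists>b3 b2 b1 b0. \<forall>l. char_quartic P U l = l^4 + b3 * l^3 + b2 * l^2 + b1 * l + b0"
    unfolding char_quartic_def Let_def diff_conv_add_uminus minus_mult_left
    by (intro exI allI) (rule refl)
  then obtain b3 b2 b1 b0 where
    q: "\<And>l. char_quartic P U l = l^4 + b3 * l^3 + b2 * l^2 + b1 * l + b0" by blast
  define p where "p = [:b0, b1, b2, b3, 1:]"
  have p: "p \<noteq> 0" "degree p = 4" by (simp_all add: p_def)
  have qp: "char_quartic P U l = poly p l" for l
    unfolding q p_def by (simp add: power2_eq_square power3_eq_cube power4_eq_xxxx algebra_simps)
  have "{l1, l2, l4, l5} = {l. poly p l = 0}"
  proof (rule card_subset_eq)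
    show "finite {l. poly p l = 0}" using p by (simp add: poly_roots_finite)
    show sub: "{l1, l2, l4, l5} \<subseteq> {l. poly p l = 0}" using roots by (auto simp: qp)
    have "card {l1, l2, l4, l5} = 4" using less by simp
    moreover have "card {l. poly p l = 0} \<le> 4" using card_poly_roots_bound[of p] p by simp
    ultimately show "card {l1, l2, l4, l5} = card {l. poly p l = 0}"
      using card_mono[OF poly_roots_finite[OF p(1)] sub] by simp
  qed
  then have iff: "char_quartic P U l = 0 \<longleftrightarrow> l = l1 \<or> l = l2 \<or> l = l4 \<or> l = l5" for l
    unfolding qp by blast
  have "eigenvalues (hns_matrix P U) = set [l1, l2, 0, l4, l5]"
    unfolding eigenvalues_eq[OF P U] iff using less by auto
  moreover have "sorted_list_of_set (set [l1, l2, 0, l4, l5]) = [l1, l2, 0, l4, l5]"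
    by (rule sorted_list_of_set.idem_if_sorted_distinct) (use less in auto)
  ultimately show "char_speed P 2 U = l2" "char_speed P 4 U = l4"
    unfolding char_speed_def by simp_all
qed

section \<open>The characteristic quartic near equilibrium\<close>

text \<open>
The discriminant exceeds both \<open>(z + \<gamma> - w)\<^sup>2\<close> and \<open>(w + \<gamma> - z - 2)\<^sup>2\<close> when \<open>\<gamma> > 1\<close>, which places the
smaller root below \<open>w\<close> and below \<open>z + 1\<close>. The product formula \<open>calL_root\<close> is the
quadratic equation for \<open>L\<close> rearranged.
\<close>

lemma calL_properties:
  fixes w z \<gamma> :: real
  assumes "w > 0" "z > 0" "\<gamma> > 1"
  defines "L \<equiv> calL \<gamma> w z"
  shows calL_pos: "0 < L" and calL_less_w: "L < w" and calL_less_z: "L < z + 1"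
    and calL_root: "(w - L) * (z + 1 - L) = (\<gamma> - 1) * L"
    and calL_less_other: "L < z + w + \<gamma> - L"
proof -
  define D where "D = (z + w + \<gamma>)^2 - 4 * (z + 1) * w"
  have Dw: "D = (z + \<gamma> - w)\<^sup>2 + 4 * (\<gamma> - 1) * w"
    and Dz: "D = (w + \<gamma> - z - 2)\<^sup>2 + 4 * (\<gamma> - 1) * (z + 1)"
    by (simp_all add: D_def power2_eq_square algebra_simps)
  have wpos: "4 * (\<gamma> - 1) * w > 0" and zpos: "4 * (\<gamma> - 1) * (z + 1) > 0" using assms by simp_all
  have D: "D > 0" unfolding Dw using wpos by (rule add_nonneg_pos[rotated]) simp
  have L: "L = ((z + w + \<gamma>) - sqrt D) / 2" by (simp add: L_def calL_def D_def)
  have "sqrt D > z + \<gamma> - w"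
    by (rule real_less_rsqrt) (use wpos in \<open>unfold Dw, linarith\<close>)
  then show "L < w" unfolding L by simp
  have "sqrt D > w + \<gamma> - z - 2"
    by (rule real_less_rsqrt) (use zpos in \<open>unfold Dz, linarith\<close>)
  then show "L < z + 1" unfolding L by simp
  have "4 * (z + 1) * w > 0" using assms by simp
  then have "D < (z + w + \<gamma>)^2" unfolding D_def by linarith
  then have "sqrt D < z + w + \<gamma>" using assms D by (intro real_less_lsqrt) auto
  then show "0 < L" by (simp add: L)
  have "0 < sqrt D" using D by simp
  moreover have L2: "2 * L = z + w + \<gamma> - sqrt D" by (simp add: L)
  ultimately show "L < z + w + \<gamma> - L" by linarith
  have "(sqrt D)\<^sup>2 = D" using D by simp
  moreover have "sqrt D = z + w + \<gamma> - 2 * L" using L2 by linarith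
  ultimately have "(z + w + \<gamma> - 2 * L)\<^sup>2 = D" by simp
  then have "(z + w + \<gamma> - 2 * L)\<^sup>2 = (z + w + \<gamma>)^2 - 4 * (z + 1) * w"
    unfolding D_def .
  then show "(w - L) * (z + 1 - L) = (\<gamma> - 1) * L"
    by (simp add: power2_eq_square algebra_simps)
qed

lemma params_eq:
  assumes "positive_params P"
  shows "kappa P / tau1 P = w_of P * Cv P * Rgas P" "kappa P / (tau1 P * Cv P) = w_of P * Rgas P"
    "mu P / tau2 P = z_of P * Rgas P"
    "Rgas P / Cv P = adiabatic P - 1" "0 < w_of P" "0 < z_of P" "1 < adiabatic P"
  using assms by (simp_all add: positive_params_def w_of_def z_of_def adiabatic_def)

text \<open>
The coefficients as rational functions of the state, the form in which they can be differentiated.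
In the linear term the factor \<open>kappa\<close> cancels against the one in \<open>p_q\<close>.
\<close>

lemma char_quartic_explicit:
  assumes P: "positive_params P" and U: "U$1 \<noteq> 0" "U$3 \<noteq> 0"
  shows "char_quartic P U l =
    (let v = U$1; \<theta> = U$3; q = U$4; S = U$5;
         E = Cv P - tau1 P * v * q\<^sup>2 / (kappa P * \<theta>\<^sup>2);
         T = Rgas P / v + tau1 P * q\<^sup>2 / (2 * kappa P * \<theta>\<^sup>2);
         c = mu P * (1 + tau2 P * S / mu P) / (tau2 P * v) + Rgas P * \<theta> / v\<^sup>2
     in l^4 + 2 * q / (\<theta> * E) * l^3 - (c + kappa P / (tau1 P * v * E) + \<theta> * T\<^sup>2 / E) * l\<^sup>2
        - (2 * q / (\<theta> * E) * c - T * q / (v * E)) * l + kappa P / (tau1 P * v * E) * c)"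
proof -
  have "kappa P * U$3 * p_theta P (U$1) (U$3) (U$4) (U$5) * p_q P (U$1) (U$3) (U$4) (U$5)
      / (tau1 P * U$1 * e) = - (p_theta P (U$1) (U$3) (U$4) (U$5) * U$4 / (U$1 * e))" for e
    using P U by (simp add: p_q_eq positive_params_def field_simps)
  then show ?thesis
    using assms unfolding char_quartic_def Let_def c0_sq_def
    by (simp add: p_v_eq p_theta_eq p_S_eq e_theta_eq)
qed

lemma ubar_nth [simp]: "ubar$1 = 1" "ubar$2 = 0" "ubar$3 = 1" "ubar$4 = 0" "ubar$5 = 0"
  by (simp_all add: ubar_def)

lemma eventually_positive:
  fixes f :: "'a::t2_space \<Rightarrow> real"
  assumes "isCont f x" "0 < f x"
  shows "\<forall>\<^sub>F y in nhds x. 0 < f y"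
  using assms by (simp add: order_tendstoD(1) isCont_def eventually_nhds_conv_at)

lemma eventually_admissible:
  assumes P: "positive_params P"
  shows "\<forall>\<^sub>F U in nhds ubar. admissible P U"
proof -
  have "\<forall>\<^sub>F U in nhds ubar. 0 < (U::real^5)$1" "\<forall>\<^sub>F U in nhds ubar. 0 < (U::real^5)$3"
    "\<forall>\<^sub>F U in nhds ubar. 0 < Cv P - tau1 P * U$1 * (U$4)\<^sup>2 / (kappa P * (U$3)\<^sup>2)"
    using P by (intro eventually_positive continuous_intros; simp add: positive_params_def)+
  then show ?thesis
    by eventually_elim (use P in \<open>auto simp: admissible_def e_theta_eq\<close>)
qed

lemma eventually_admissible_fst:
  assumes "positive_params P"
  shows "\<forall>\<^sub>F X in nhds (ubar, l). admissible P (fst X)"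
  unfolding nhds_prod eventually_prod_filter
  using eventually_admissible[OF assms]
  by (intro exI[of _ "admissible P"] exI[of _ "\<lambda>_. True"]) simp

lemma char_quartic_ubar:
  assumes P: "positive_params P"
  defines "L \<equiv> calL (adiabatic P) (w_of P) (z_of P)"
  shows "char_quartic P ubar l =
    (l\<^sup>2 - Rgas P * L) * (l\<^sup>2 - Rgas P * (z_of P + w_of P + adiabatic P - L))"
proof -
  define R w z \<gamma> where "R = Rgas P" and "w = w_of P" and "z = z_of P" and "\<gamma> = adiabatic P"
  note par = params_eq[OF P, folded R_def w_def z_def \<gamma>_def]
  note K = par(2)
  have K': "kappa P * x / (tau1 P * Cv P) = w * R * x" for x
    unfolding K[symmetric] by simp
  have M: "R\<^sup>2 / Cv P = R * (\<gamma> - 1)" unfolding par(4)[symmetric] by (simp add: power2_eq_square)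
  have root: "(w - L) * (z + 1 - L) = (\<gamma> - 1) * L"
    unfolding L_def using calL_root[OF par(5,6,7)] by (simp add: w_def z_def \<gamma>_def)
  have "char_quartic P ubar l = l^4 - (z * R + R + w * R + R * (\<gamma> - 1)) * l\<^sup>2 + w * R * (z * R + R)"
    by (simp add: char_quartic_explicit[OF P] Let_def par(3) K K' M R_def[symmetric])
  also have "\<dots> = (l\<^sup>2 - R * L) * (l\<^sup>2 - R * (z + w + \<gamma> - L)) + R\<^sup>2 * ((w - L) * (z + 1 - L) - (\<gamma> - 1) * L)"
    by (simp add: power2_eq_square power4_eq_xxxx algebra_simps)
  finally show ?thesis using root by (simp add: R_def w_def z_def \<gamma>_def)
qed

text \<open>
The positive roots at equilibrium are \<open>s\<close> and the larger \<open>s'\<close>, whose square comes from the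
larger root of the quadratic equation for \<open>calL\<close>.
\<close>

lemma equilibrium_speeds:
  assumes P: "positive_params P"
  defines "s \<equiv> sqrt (Rgas P * calL (adiabatic P) (w_of P) (z_of P))"
  obtains s' where "0 < s" "s < s'"
    "\<And>l. char_quartic P ubar l = (l\<^sup>2 - s\<^sup>2) * (l\<^sup>2 - s'\<^sup>2)"
proof -
  define L where "L = calL (adiabatic P) (w_of P) (z_of P)"
  define L' where "L' = z_of P + w_of P + adiabatic P - L"
  have L: "0 < L" "L < L'"
    using calL_pos calL_less_other params_eq[OF P] by (auto simp: L_def L'_def)
  have R: "Rgas P > 0" using P by (simp add: positive_params_def)
  define s' where "s' = sqrt (Rgas P * L')"
  have s: "0 < s" "s < s'" "s\<^sup>2 = Rgas P * L" "s'\<^sup>2 = Rgas P * L'"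
    using L R by (simp_all add: s_def s'_def L_def[symmetric])
  show thesis
    by (rule that[of s']) (use s in \<open>simp_all add: char_quartic_ubar[OF P] L_def[symmetric] L'_def\<close>)
qed

lemma eigendirection_ubar:
  assumes P: "positive_params P"
    and l: "l\<^sup>2 = Rgas P * calL (adiabatic P) (w_of P) (z_of P)"
  shows "eigendirection P ubar l = r_star P l"
proof -
  define R w z \<gamma> where "R = Rgas P" and "w = w_of P" and "z = z_of P" and "\<gamma> = adiabatic P"
  note par = params_eq[OF P, folded R_def w_def z_def \<gamma>_def]
  define L where "L = calL \<gamma> w z"
  have pos: "Cv P > 0" "R > 0" using P by (simp_all add: positive_params_def R_def)
  note K = par(2)
  have e: "e_theta P 1 1 0 0 = Cv P" "p_theta P 1 1 0 0 = R"
    using P by (simp_all add: e_theta_eq p_theta_eq R_def)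
  have l2: "l\<^sup>2 = R * L" using l by (simp add: R_def L_def w_def z_def \<gamma>_def)
  have C: "Cv P * (\<gamma> - 1) = R" using pos unfolding par(4)[symmetric] by simp
  have k: "kappa P * (l * (\<gamma> - 1)) / tau1 P = R\<^sup>2 * w * l"
  proof -
    have "kappa P * (l * (\<gamma> - 1)) / tau1 P = kappa P / tau1 P * (l * (\<gamma> - 1))" by simp
    also have "\<dots> = w * R * l * (Cv P * (\<gamma> - 1))" by (simp only: par(1) mult_ac)
    finally show ?thesis by (simp only: C power2_eq_square mult_ac)
  qed
  have "eigendirection P ubar l = vector [w * R - R * L, l * (R * L - w * R), R * L * (\<gamma> - 1),
      R\<^sup>2 * w * l, - (z * R * (R * L - w * R))]"
    unfolding eigendirection_def Let_def
    by (simp add: e par(3,4) K l2 k R_def[symmetric] w_def[symmetric] z_def[symmetric] \<gamma>_def[symmetric])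
  then show ?thesis
    by (simp add: r_star_def Let_def R_def w_def z_def \<gamma>_def L_def algebra_simps power2_eq_square)
qed

text \<open>
This is \<open>\<nabla>\<Pi>\<close> at the equilibrium for arbitrary fixed \<open>l\<close>. The terms quadratic in the heat flux
contribute nothing, so the derivatives of \<open>e_theta\<close> and of the \<open>q\<close>-part of \<open>p_theta\<close> vanish there.
\<close>

lemma char_quartic_state_derivative_ubar:
  assumes P: "positive_params P"
  defines "R \<equiv> Rgas P" and "w \<equiv> w_of P" and "z \<equiv> z_of P" and "\<gamma> \<equiv> adiabatic P"
  shows "((\<lambda>U. char_quartic P U l) has_derivative
    (\<lambda>h. (R * (z + w + 2 * \<gamma>) * l\<^sup>2 - R\<^sup>2 * w * (2 * z + 3)) * h$1
       + (R\<^sup>2 * w - R * \<gamma> * l\<^sup>2) * h$3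
       + (\<gamma> - 1) / R * (2 * l^3 - R * (2 * z + 1) * l) * h$4
       + (R * w - l\<^sup>2) * h$5)) (at ubar)"
proof -
  note par = params_eq[OF P, folded R_def w_def z_def \<gamma>_def]
  have pos: "Cv P > 0" "R > 0" "kappa P > 0" "tau1 P > 0" "mu P > 0" "tau2 P > 0"
    using P by (simp_all add: positive_params_def R_def)
  define E where "E U = Cv P - tau1 P * U$1 * (U$4)\<^sup>2 / (kappa P * (U$3)\<^sup>2)" for U :: "real^5"
  define T where "T U = Rgas P / U$1 + tau1 P * (U$4)\<^sup>2 / (2 * kappa P * (U$3)\<^sup>2)" for U :: "real^5"
  define c where "c U = mu P * (1 + tau2 P * U$5 / mu P) / (tau2 P * U$1) + Rgas P * U$3 / (U$1)\<^sup>2"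
    for U :: "real^5"
  define b where "b U = 2 * U$4 / (U$3 * E U)" for U
  define k where "k U = kappa P / (tau1 P * U$1 * E U)" for U
  define s where "s U = U$3 * (T U)\<^sup>2 / E U" for U
  define t where "t U = T U * U$4 / (U$1 * E U)" for U
  define F where "F U = l^4 + b U * l^3 - (c U + k U + s U) * l\<^sup>2 - (b U * c U - t U) * l + k U * c U" for U
  have val: "E ubar = Cv P" "T ubar = R" "c ubar = (z + 1) * R"
    using par(3) by (simp_all add: E_def T_def c_def R_def algebra_simps)
  note K = par(2)
  have bval: "b ubar = 0" "k ubar = w * R" "c ubar = (z + 1) * R"
    using K by (simp_all add: b_def k_def val)
  have C: "R = Cv P * (\<gamma> - 1)" using pos unfolding par(4)[symmetric] by simp
  have nth: "((\<lambda>U. U $ i) has_derivative (\<lambda>h. h $ i)) F" for i :: 5 and F :: "(real^5) filter"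
    by (rule bounded_linear_imp_has_derivative) (rule bounded_linear_vec_nth)
  have dE: "(E has_derivative (\<lambda>h. 0)) (at ubar)"
    unfolding E_def using pos by (auto intro!: derivative_eq_intros nth)
  have dT: "(T has_derivative (\<lambda>h. - R * h$1)) (at ubar)"
    unfolding T_def using pos by (auto intro!: derivative_eq_intros nth simp: R_def)
  have "(c has_derivative (\<lambda>h. h$5 - mu P / tau2 P * h$1 + R * h$3 - 2 * R * h$1)) (at ubar)"
    unfolding c_def using pos by (auto intro!: derivative_eq_intros nth simp: R_def fun_eq_iff field_simps)
  then have dc: "(c has_derivative (\<lambda>h. h$5 - z * R * h$1 + R * h$3 - 2 * R * h$1)) (at ubar)"
    unfolding par(3) .
  have db: "(b has_derivative (\<lambda>h. 2 / Cv P * h$4)) (at ubar)"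
    unfolding b_def using pos
    by (auto intro!: derivative_eq_intros nth dE simp: val fun_eq_iff field_simps)
  have "(k has_derivative (\<lambda>h. - (kappa P / (tau1 P * Cv P)) * h$1)) (at ubar)"
    unfolding k_def using pos
    by (auto intro!: derivative_eq_intros nth dE simp: val fun_eq_iff field_simps)
  then have dK: "(k has_derivative (\<lambda>h. - (w * R) * h$1)) (at ubar)"
    unfolding K .
  have ds: "(s has_derivative (\<lambda>h. R\<^sup>2 / Cv P * (h$3 - 2 * h$1))) (at ubar)"
    unfolding s_def using pos
    by (auto intro!: derivative_eq_intros nth dE dT simp: val fun_eq_iff field_simps power2_eq_square)
  have dt: "(t has_derivative (\<lambda>h. R / Cv P * h$4)) (at ubar)"
    unfolding t_def using pos
    by (auto intro!: derivative_eq_intros nth dE dT simp: val fun_eq_iff field_simps power2_eq_square)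
  have "(F has_derivative
    (\<lambda>h. (R * (z + w + 2 * \<gamma>) * l\<^sup>2 - R\<^sup>2 * w * (2 * z + 3)) * h$1
       + (R\<^sup>2 * w - R * \<gamma> * l\<^sup>2) * h$3
       + (\<gamma> - 1) / R * (2 * l^3 - R * (2 * z + 1) * l) * h$4
       + (R * w - l\<^sup>2) * h$5)) (at ubar)"
    unfolding F_def
    by (rule derivative_eq_intros db dK ds dt dc refl)+
       (rule ext, use pos in \<open>simp add: bval,
         simp add: C field_simps power2_eq_square power3_eq_cube\<close>)
  moreover have "\<forall>\<^sub>F U in at ubar. F U = char_quartic P U l"
  proof -
    have "\<forall>\<^sub>F U in nhds ubar. F U = char_quartic P U l"
      using eventually_admissible[OF P]
      by eventually_elim
         (simp add: admissible_def char_quartic_explicit[OF P] Let_def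
           F_def b_def k_def s_def t_def E_def T_def c_def)
    then show ?thesis by (simp add: eventually_nhds_conv_at)
  qed
  moreover have "F ubar = char_quartic P ubar l"
    by (simp add: char_quartic_explicit[OF P] Let_def
        F_def b_def k_def s_def t_def E_def T_def c_def)
  ultimately show ?thesis
    using has_derivative_transform_eventually[of F _ ubar UNIV "\<lambda>U. char_quartic P U l"] by simp
qed

lemma C1_at_char_quartic:
  assumes P: "positive_params P"
  shows "C1_at (\<lambda>X. char_quartic P (fst X) (snd X)) (ubar, l)"
proof (rule C1_at_cong)
  have nth: "C1_at (\<lambda>X::(real^5) \<times> real. fst X $ i) x" for i x
    by (rule C1_at_bounded_linear)
       (rule bounded_linear_compose[OF bounded_linear_vec_nth bounded_linear_fst])
  have snd: "C1_at (snd :: (real^5) \<times> real \<Rightarrow> real) x" for x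
    by (rule C1_at_bounded_linear) (rule bounded_linear_snd)
  have pos: "Cv P > 0" "kappa P > 0" "tau1 P > 0" "mu P > 0" "tau2 P > 0"
    using P by (simp_all add: positive_params_def)
  show "C1_at (\<lambda>X::(real^5) \<times> real. let v = fst X $ 1; \<theta> = fst X $ 3; q = fst X $ 4; S = fst X $ 5; l = snd X;
         E = Cv P - tau1 P * v * q\<^sup>2 / (kappa P * \<theta>\<^sup>2);
         T = Rgas P / v + tau1 P * q\<^sup>2 / (2 * kappa P * \<theta>\<^sup>2);
         c = mu P * (1 + tau2 P * S / mu P) / (tau2 P * v) + Rgas P * \<theta> / v\<^sup>2
     in l^4 + 2 * q / (\<theta> * E) * l^3 - (c + kappa P / (tau1 P * v * E) + \<theta> * T\<^sup>2 / E) * l\<^sup>2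
        - (2 * q / (\<theta> * E) * c - T * q / (v * E)) * l + kappa P / (tau1 P * v * E) * c) (ubar, l)"
    unfolding Let_def using pos by (intro C1_intros nth snd) simp_all
  show "\<forall>\<^sub>F X in nhds (ubar, l). (let v = fst X $ 1; \<theta> = fst X $ 3; q = fst X $ 4; S = fst X $ 5; l = snd X;
         E = Cv P - tau1 P * v * q\<^sup>2 / (kappa P * \<theta>\<^sup>2);
         T = Rgas P / v + tau1 P * q\<^sup>2 / (2 * kappa P * \<theta>\<^sup>2);
         c = mu P * (1 + tau2 P * S / mu P) / (tau2 P * v) + Rgas P * \<theta> / v\<^sup>2
     in l^4 + 2 * q / (\<theta> * E) * l^3 - (c + kappa P / (tau1 P * v * E) + \<theta> * T\<^sup>2 / E) * l\<^sup>2
        - (2 * q / (\<theta> * E) * c - T * q / (v * E)) * l + kappa P / (tau1 P * v * E) * c)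
        = char_quartic P (fst X) (snd X)"
    using eventually_admissible_fst[OF P]
    by eventually_elim (simp add: admissible_def char_quartic_explicit[OF P] Let_def)
qed

lemma isCont_eigendirection:
  assumes P: "positive_params P"
  shows "isCont (\<lambda>X. eigendirection P (fst X) (snd X)) (ubar, l)"
proof -
  have nth: "isCont (\<lambda>X::(real^5) \<times> real. fst X $ i) x" for i x
    by (intro continuous_intros)
  have pos: "Cv P > 0" "kappa P > 0" "tau1 P > 0" "mu P > 0" "tau2 P > 0"
    using P by (simp_all add: positive_params_def)
  define E where "E X = Cv P - tau1 P * fst X $ 1 * (fst X $ 4)\<^sup>2 / (kappa P * (fst X $ 3)\<^sup>2)"
    for X :: "(real^5) \<times> real"
  define k where "k X = kappa P / (tau1 P * fst X $ 1)" for X :: "(real^5) \<times> real"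
  define J where "J X = (snd X)\<^sup>2 + 2 * fst X $ 4 / (fst X $ 3 * E X) * snd X - k X / E X" for X
  define T where "T X = fst X $ 3 *
      (Rgas P / fst X $ 1 + tau1 P * (fst X $ 4)\<^sup>2 / (2 * kappa P * (fst X $ 3)\<^sup>2)) / E X" for X
  have cE: "isCont E (ubar, l)" unfolding E_def using pos by (intro continuous_intros nth) simp_all
  have E: "E (ubar, l) \<noteq> 0" using pos by (simp add: E_def)
  have ck: "isCont k (ubar, l)" unfolding k_def using pos by (intro continuous_intros nth) simp_all
  have cJ: "isCont J (ubar, l)" unfolding J_def using E by (intro continuous_intros nth cE ck) simp_all
  have cT: "isCont T (ubar, l)" unfolding T_def using pos E by (intro continuous_intros nth cE) simp_all
  have "isCont (\<lambda>X. vector [- J X, snd X * J X, (snd X)\<^sup>2 * T X, k X * (snd X * T X),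
      - (mu P / (tau2 P * fst X $ 1) * J X)] :: real^5) (ubar, l)"
    using pos by (intro continuous_vector_5 continuous_intros nth cJ cT ck) simp_all
  moreover have "\<forall>\<^sub>F X in nhds (ubar, l). eigendirection P (fst X) (snd X) =
      vector [- J X, snd X * J X, (snd X)\<^sup>2 * T X, k X * (snd X * T X),
        - (mu P / (tau2 P * fst X $ 1) * J X)]"
    using eventually_admissible_fst[OF P]
    by eventually_elim
       (use P in \<open>simp add: admissible_def eigendirection_def Let_def e_theta_eq p_theta_eq
          E_def J_def k_def T_def\<close>)
  ultimately show ?thesis by (simp add: isCont_cong)
qed

section \<open>The Riemann invariant\<close>

text \<open>
The negative of the Riemann invariant, rearranged through the quadratic equation for \<open>L\<close> so that
its sign can be read off.
\<close>

definition riemann_form :: "real \<Rightarrow> real \<Rightarrow> real \<Rightarrow> real" where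
  "riemann_form \<gamma> w z =
     (let L = calL \<gamma> w z; X = w - L; Y = (\<gamma> - 1) * L
      in 2 * X\<^sup>2 - 3 * X * Y + 3 * Y\<^sup>2 + 2 * (z + 1 - L) * Y * L)"

lemma riemann_form_pos:
  assumes "w > 0" "z > 0" "\<gamma> > 1"
  shows "0 < riemann_form \<gamma> w z"
proof -
  define L X Y where "L = calL \<gamma> w z" and "X = w - L" and "Y = (\<gamma> - 1) * L"
  have pos: "L > 0" "X > 0" "Y > 0" "z + 1 - L > 0"
    using calL_pos[OF assms] calL_less_w[OF assms] calL_less_z[OF assms] assms(3)
    by (simp_all add: L_def X_def Y_def)
  have "2 * X\<^sup>2 - 3 * X * Y + 3 * Y\<^sup>2 = 2 * (X - 3 / 4 * Y)\<^sup>2 + 15 / 8 * Y\<^sup>2"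
    by (simp add: power2_eq_square algebra_simps)
  moreover have "0 < 15 / 8 * Y\<^sup>2" "0 \<le> 2 * (X - 3 / 4 * Y)\<^sup>2" using pos by simp_all
  moreover have "0 < 2 * (z + 1 - L) * Y * L" using pos by simp
  ultimately have "0 < 2 * X\<^sup>2 - 3 * X * Y + 3 * Y\<^sup>2 + 2 * (z + 1 - L) * Y * L" by linarith
  then show ?thesis by (simp add: riemann_form_def Let_def L_def X_def Y_def)
qed

text \<open>
Once \<open>l\<^sup>2\<close> is replaced by \<open>R L\<close>, both sides are polynomials in \<open>w\<close>, \<open>z\<close>, \<open>\<gamma>\<close>, \<open>L\<close> that differ by a multiple of
\<open>(w - L) (z + 1 - L) - (\<gamma> - 1) L\<close>, which is zero. Only even powers of \<open>l\<close> survive, so the value is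
the same for \<open>\<lambda>\<^sub>2\<close> and \<open>\<lambda>\<^sub>4\<close>.
\<close>

lemma riemann_at_eq:
  assumes P: "positive_params P"
    and l: "l\<^sup>2 = Rgas P * calL (adiabatic P) (w_of P) (z_of P)"
  shows "riemann_at P l = - riemann_form (adiabatic P) (w_of P) (z_of P)"
proof -
  define R w z \<gamma> where "R = Rgas P" and "w = w_of P" and "z = z_of P" and "\<gamma> = adiabatic P"
  define L where "L = calL \<gamma> w z"
  note par = params_eq[OF P, folded R_def w_def z_def \<gamma>_def]
  have R: "R > 0" using P by (simp add: positive_params_def R_def)
  have l2: "l\<^sup>2 = R * L" using l by (simp add: R_def L_def w_def z_def \<gamma>_def)
  have root: "(w - L) * (z + 1 - L) = (\<gamma> - 1) * L"
    unfolding L_def by (rule calL_root[OF par(5,6,7)])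
  have l34: "(2 * l^3 - R * (2 * z + 1) * l) * (R\<^sup>2 * w * l)
      = R\<^sup>2 * w * (2 * (l\<^sup>2)\<^sup>2 - R * (2 * z + 1) * l\<^sup>2)"
    by (simp add: power2_eq_square power3_eq_cube algebra_simps)
  have "grad (\<lambda>U. char_quartic P U l) ubar \<bullet> r_star P l =
      (R * (z + w + 2 * \<gamma>) * l\<^sup>2 - R\<^sup>2 * w * (2 * z + 3)) * (R * (w - L))
      + (R\<^sup>2 * w - R * \<gamma> * l\<^sup>2) * ((\<gamma> - 1) * R * L)
      + (\<gamma> - 1) / R * ((2 * l^3 - R * (2 * z + 1) * l) * (R\<^sup>2 * w * l))
      + (R * w - l\<^sup>2) * (R\<^sup>2 * z * (w - L))"
    unfolding grad_inner[OF char_quartic_state_derivative_ubar[OF P]]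
    by (simp add: r_star_def Let_def R_def w_def z_def \<gamma>_def L_def)
  also have "\<dots> = R ^ 3 * ((w - L) * ((z + w + 2 * \<gamma>) * L - w * (2 * z + 3))
      + (w - \<gamma> * L) * (\<gamma> - 1) * L + (\<gamma> - 1) * w * L * (2 * L - (2 * z + 1)) + z * (w - L)\<^sup>2)"
    unfolding l34 l2 using R by (simp add: power2_eq_square power3_eq_cube field_simps)
  also have "\<dots> = R ^ 3 * (- riemann_form \<gamma> w z
      - (w + 2 * (\<gamma> - 1) * L) * ((w - L) * (z + 1 - L) - (\<gamma> - 1) * L))"
    by (simp add: riemann_form_def Let_def L_def[symmetric] power2_eq_square algebra_simps)
  finally show ?thesis
    using R root by (simp add: riemann_at_def R_def[symmetric] w_def[symmetric] z_def[symmetric]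
      \<gamma>_def[symmetric])
qed

lemma char_speed_ubar:
  assumes P: "positive_params P"
  defines "s \<equiv> sqrt (Rgas P * calL (adiabatic P) (w_of P) (z_of P))"
  shows "char_speed P 2 ubar = - s" and "char_speed P 4 ubar = s"
proof -
  obtain s' where s: "0 < s" "s < s'"
    and roots: "\<And>l. char_quartic P ubar l = (l\<^sup>2 - s\<^sup>2) * (l\<^sup>2 - s'\<^sup>2)"
    using equilibrium_speeds[OF P] unfolding s_def by blast
  have adm: "admissible P ubar" by (rule eventually_nhds_x_imp_x[OF eventually_admissible[OF P]])
  show "char_speed P 2 ubar = - s" "char_speed P 4 ubar = s"
    using char_speed_eqI[OF P adm, of "- s'" "- s" s s'] s(1,2) by (simp_all add: roots)
qed

text \<open>
Without parameters realising \<open>(\<gamma>, w, z)\<close>, the value of \<open>riemann_invariant\<close> would not be unique.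
\<close>

lemma ex_params:
  assumes "w > 0" "z > 0" "\<gamma> > 1"
  shows "\<exists>P. positive_params P \<and> adiabatic P = \<gamma> \<and> w_of P = w \<and> z_of P = z"
  by (rule exI[of _ "\<lparr>tau1 = 1, tau2 = 1, kappa = w / (\<gamma> - 1), mu = z, Rgas = 1, Cv = 1 / (\<gamma> - 1)\<rparr>"])
     (use assms in \<open>simp add: positive_params_def adiabatic_def w_of_def z_of_def\<close>)

lemma riemann_invariant_eq:
  assumes "w > 0" "z > 0" "\<gamma> > 1"
  shows "riemann_invariant \<gamma> w z = - riemann_form \<gamma> w z"
proof -
  have val: "riemann_at P (char_speed P i ubar) = - riemann_form \<gamma> w z"
    if P: "positive_params P" "adiabatic P = \<gamma>" "w_of P = w" "z_of P = z" "i \<in> {2, 4}" for P i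
  proof -
    have "Rgas P * calL \<gamma> w z > 0"
      using P(1) calL_pos[OF assms] by (simp add: positive_params_def)
    then have "(char_speed P i ubar)\<^sup>2 = Rgas P * calL \<gamma> w z"
      using char_speed_ubar[OF P(1)] P by auto
    then show ?thesis using riemann_at_eq[OF P(1)] P by simp
  qed
  show ?thesis
    unfolding riemann_invariant_def
  proof (rule the_equality)
    fix \<rho>
    assume \<rho>: "\<forall>P. positive_params P \<and> adiabatic P = \<gamma> \<and> w_of P = w \<and> z_of P = z \<longrightarrow>
        (\<forall>i\<in>{2, 4}. riemann_at P (char_speed P i ubar) = \<rho>)"
    obtain P where "positive_params P" "adiabatic P = \<gamma>" "w_of P = w" "z_of P = z"
      using ex_params[OF assms] by blast
    then show "\<rho> = - riemann_form \<gamma> w z" using \<rho> val[of P 2] by auto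
  qed (use val in blast)
qed

section \<open>Genuine nonlinearity near equilibrium\<close>

text \<open>
At the equilibrium the quartic alternates in sign along
\<open>- (s' + 1) < - (s + d) < - (s - d) < s - d < s + d < s' + 1\<close> except across the middle gap, where it
is positive at both ends. These finitely many strict inequalities persist nearby, and the
intermediate value theorem then gives one root in each of the other four gaps. The small
\<open>d\<close> confines two of them to \<open>\<epsilon>\<close>-neighbourhoods of \<open>- s\<close> and \<open>s\<close>.
\<close>

lemma eventually_char_speeds_near:
  assumes P: "positive_params P"
  defines "s \<equiv> sqrt (Rgas P * calL (adiabatic P) (w_of P) (z_of P))"
  assumes "0 < \<epsilon>"
  shows "\<forall>\<^sub>F U in nhds ubar. admissible P U \<and>
    \<bar>char_speed P 2 U + s\<bar> < \<epsilon> \<and> char_quartic P U (char_speed P 2 U) = 0 \<and>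
    \<bar>char_speed P 4 U - s\<bar> < \<epsilon> \<and> char_quartic P U (char_speed P 4 U) = 0"
proof -
  obtain s' where s: "0 < s" "s < s'"
    and quartic: "\<And>l. char_quartic P ubar l = (l\<^sup>2 - s\<^sup>2) * (l\<^sup>2 - s'\<^sup>2)"
    using equilibrium_speeds[OF P] unfolding s_def by blast
  \<comment> \<open>The bounds by \<open>s\<close> and \<open>s' - s\<close> keep the intervals around \<open>s\<close> clear of \<open>0\<close> and \<open>s'\<close>.\<close>
  define d where "d = min (min \<epsilon> s) (s' - s) / 2"
  have d: "0 < d" "d < \<epsilon>" "d < s" "s + d < s'"
    using s \<open>0 < \<epsilon>\<close> by (auto simp: d_def min_def field_simps)
  have sq_less: "x\<^sup>2 < y\<^sup>2" if "0 \<le> x" "x < y" for x y :: real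
    using that by (simp add: power_strict_mono)
  have sq: "(s - d)\<^sup>2 < s\<^sup>2" "s\<^sup>2 < (s + d)\<^sup>2" "(s + d)\<^sup>2 < s'\<^sup>2" "s'\<^sup>2 < (s' + 1)\<^sup>2"
    using s d by (intro sq_less; simp)+
  have val: "0 < char_quartic P ubar l" if "l \<in> {s - d, - (s - d), s' + 1, - (s' + 1)}" for l
  proof -
    have "l\<^sup>2 = (s - d)\<^sup>2 \<or> l\<^sup>2 = (s' + 1)\<^sup>2"
      using that by (metis insertE power2_minus singletonD)
    then show ?thesis
    proof
      assume "l\<^sup>2 = (s - d)\<^sup>2"
      then show ?thesis unfolding quartic using sq by (intro mult_neg_neg) linarith+
    next
      assume "l\<^sup>2 = (s' + 1)\<^sup>2"
      then show ?thesis unfolding quartic using sq by (intro mult_pos_pos) linarith+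
    qed
  qed
  have val': "0 < - char_quartic P ubar l" if "l \<in> {s + d, - (s + d)}" for l
  proof -
    have "l\<^sup>2 = (s + d)\<^sup>2" using that by (metis insertE power2_minus singletonD)
    then show ?thesis unfolding quartic using sq by (auto intro!: mult_pos_neg)
  qed
  have cont: "isCont (\<lambda>U. char_quartic P U l) ubar" for l
  proof -
    have "isCont (\<lambda>U. (U, l)) ubar" by (intro continuous_intros)
    from isCont_o2[OF this, of "\<lambda>X. char_quartic P (fst X) (snd X)"] show ?thesis
      using C1_at_imp_isCont[OF C1_at_char_quartic[OF P, of l]] by simp
  qed
  have "\<forall>\<^sub>F U in nhds ubar. \<forall>l\<in>{s - d, - (s - d), s' + 1, - (s' + 1)}. 0 < char_quartic P U l"
    by (intro eventually_ball_finite ballI eventually_positive cont val) auto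
  moreover have "\<forall>\<^sub>F U in nhds ubar. \<forall>l\<in>{s + d, - (s + d)}. 0 < - char_quartic P U l"
    by (intro eventually_ball_finite ballI eventually_positive continuous_minus cont val') auto
  moreover note eventually_admissible[OF P]
  ultimately show ?thesis
  proof eventually_elim
    case (elim U)
    let ?Q = "char_quartic P U"
    have contQ: "isCont ?Q l" for l
      unfolding char_quartic_def Let_def by (intro continuous_intros)
    have neg: "?Q (s + d) < 0" "?Q (- (s + d)) < 0" and pos: "0 < ?Q (s - d)" "0 < ?Q (- (s - d))"
      "0 < ?Q (s' + 1)" "0 < ?Q (- (s' + 1))"
      using elim by auto
    have up: "\<exists>l>a. l < b \<and> ?Q l = 0" if "a < b" "?Q a < 0" "0 < ?Q b" for a b
      using IVT[of ?Q a 0 b] that contQ by (metis less_eq_real_def less_irrefl)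
    have down: "\<exists>l>a. l < b \<and> ?Q l = 0" if "a < b" "0 < ?Q a" "?Q b < 0" for a b
      using IVT2[of ?Q b 0 a] that contQ by (metis less_eq_real_def less_irrefl)
    obtain l1 where l1: "l1 < - (s + d)" "?Q l1 = 0"
      using down[of "- (s' + 1)" "- (s + d)"] neg pos s d by auto
    obtain l2 where l2: "- (s + d) < l2" "l2 < - (s - d)" "?Q l2 = 0"
      using up[of "- (s + d)" "- (s - d)"] neg pos d by auto
    obtain l4 where l4: "s - d < l4" "l4 < s + d" "?Q l4 = 0"
      using down[of "s - d" "s + d"] neg pos d by auto
    obtain l5 where l5: "s + d < l5" "?Q l5 = 0"
      using up[of "s + d" "s' + 1"] neg pos s d by auto
    have "char_speed P 2 U = l2" "char_speed P 4 U = l4"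
      using char_speed_eqI[OF P elim(3) l1(2) l2(3) l4(3) l5(2)] l1 l2 l4 l5 d by auto
    then show ?case using elim(3) l2 l4 d by auto
  qed
qed

text \<open>
All the information about the eigenvalue \<open>lam\<close> that enters is that it is a root of the quartic which
tends to \<open>l\<close> at the equilibrium. The two nonvanishing conditions hold at \<open>(ubar, l)\<close>:
the first since \<open>l\<close> is a simple root, the second since the eigendirection at equilibrium
is \<open>r_star\<close>, so that the derivative along it is \<open>R\<^sup>3\<close> times the Riemann invariant.
\<close>

lemma eventually_genuinely_nonlinear:
  assumes P: "positive_params P"
    and l: "l \<noteq> 0" "l\<^sup>2 = Rgas P * calL (adiabatic P) (w_of P) (z_of P)"
    and near: "\<And>\<epsilon>. 0 < \<epsilon> \<Longrightarrow> \<forall>\<^sub>F U in nhds ubar. admissible P U \<and> \<bar>lam U - l\<bar> < \<epsilon> \<and>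
      char_quartic P U (lam U) = 0"
  shows "\<forall>\<^sub>F U in nhds ubar. genuinely_nonlinear (hns_matrix P) lam U"
proof -
  obtain s' where s': "l\<^sup>2 < s'\<^sup>2" "\<And>t. char_quartic P ubar t = (t\<^sup>2 - l\<^sup>2) * (t\<^sup>2 - s'\<^sup>2)"
  proof (rule equilibrium_speeds[OF P])
    fix s'
    let ?s = "sqrt (Rgas P * calL (adiabatic P) (w_of P) (z_of P))"
    assume "0 < ?s" "?s < s'" "\<And>t. char_quartic P ubar t = (t\<^sup>2 - ?s\<^sup>2) * (t\<^sup>2 - s'\<^sup>2)"
    moreover have "?s\<^sup>2 = l\<^sup>2" unfolding l(2)[symmetric] by simp
    ultimately show thesis
      using power_strict_mono[of ?s s' 2] by (intro that[of s']) simp_all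
  qed
  define F where "F = (\<lambda>X. char_quartic P (fst X) (snd X))"
  obtain F' where F': "isCont F' (ubar, l)"
    and dF: "\<forall>\<^sub>F X in nhds (ubar, l). (F has_derivative blinfun_apply (F' X)) (at X)"
    using C1_at_char_quartic[OF P, of l] unfolding C1_at_def F_def by blast
  have dF0: "(F has_derivative blinfun_apply (F' (ubar, l))) (at (ubar, l))"
    by (rule eventually_nhds_x_imp_x[OF dF])

  have "F' (ubar, l) (0, 1) \<noteq> 0"
  proof -
    have pair: "((\<lambda>t. (ubar, t)) has_derivative (\<lambda>h. (0, h))) (at l)"
      by (rule has_derivative_Pair[OF has_derivative_const has_derivative_ident])
    have "((\<lambda>t. char_quartic P ubar t) has_derivative (\<lambda>h. F' (ubar, l) (0, h))) (at l)"
      using has_derivative_compose[OF pair dF0] by (simp add: F_def)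
    moreover have "((\<lambda>t. char_quartic P ubar t) has_derivative
        (\<lambda>h. h * (2 * l * (l\<^sup>2 - s'\<^sup>2)))) (at l)"
      unfolding s'(2) by (auto intro!: derivative_eq_intros simp: fun_eq_iff)
    ultimately have "(\<lambda>h. F' (ubar, l) (0, h)) = (\<lambda>h. h * (2 * l * (l\<^sup>2 - s'\<^sup>2)))"
      by (rule has_derivative_unique)
    then have "F' (ubar, l) (0, 1) = 1 * (2 * l * (l\<^sup>2 - s'\<^sup>2))" by (rule fun_cong)
    moreover have "l\<^sup>2 - s'\<^sup>2 \<noteq> 0" using s'(1) by simp
    ultimately show ?thesis using l(1) by simp
  qed
  moreover have "isCont (\<lambda>X. F' X (0, 1)) (ubar, l)" using F' by (intro continuous_intros)
  ultimately have nz1: "\<forall>\<^sub>F X in nhds (ubar, l). F' X (0, 1) \<noteq> 0"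
    using tendsto_imp_eventually_ne by (force simp: eventually_nhds_conv_at isCont_def)

  have "F' (ubar, l) (eigendirection P ubar l, 0) \<noteq> 0"
  proof -
    have pair: "((\<lambda>U. (U, l)) has_derivative (\<lambda>h. (h, 0))) (at ubar)"
      by (rule has_derivative_Pair[OF has_derivative_ident has_derivative_const])
    have "((\<lambda>U. char_quartic P U l) has_derivative (\<lambda>h. F' (ubar, l) (h, 0))) (at ubar)"
      using has_derivative_compose[OF pair dF0] by (simp add: F_def)
    from grad_inner[OF this, of "r_star P l"]
    have "riemann_at P l = F' (ubar, l) (eigendirection P ubar l, 0) / Rgas P ^ 3"
      unfolding eigendirection_ubar[OF P l(2)] by (simp add: riemann_at_def)
    moreover have "riemann_at P l < 0"
      using riemann_at_eq[OF P l(2)] riemann_form_pos params_eq[OF P] by simp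
    ultimately show ?thesis by auto
  qed
  moreover have "isCont (\<lambda>X. F' X (eigendirection P (fst X) (snd X), 0)) (ubar, l)"
    using F' isCont_eigendirection[OF P] by (intro continuous_intros)
  ultimately have nz2: "\<forall>\<^sub>F X in nhds (ubar, l). F' X (eigendirection P (fst X) (snd X), 0) \<noteq> 0"
    using tendsto_imp_eventually_ne by (force simp: eventually_nhds_conv_at isCont_def)

  have "\<forall>\<^sub>F X in nhds ubar \<times>\<^sub>F nhds l. (F has_derivative blinfun_apply (F' X)) (at X) \<and>
      F' X (0, 1) \<noteq> 0 \<and> F' X (eigendirection P (fst X) (snd X), 0) \<noteq> 0"
    unfolding nhds_prod[symmetric] using dF nz1 nz2 by eventually_elim simp
  then obtain A T where A: "eventually A (nhds ubar)" and T: "eventually T (nhds l)"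
    and AT: "\<And>U t. A U \<Longrightarrow> T t \<Longrightarrow> (F has_derivative blinfun_apply (F' (U, t))) (at (U, t)) \<and>
      F' (U, t) (0, 1) \<noteq> 0 \<and> F' (U, t) (eigendirection P U t, 0) \<noteq> 0"
    unfolding eventually_prod_filter by auto
  obtain e where "e > 0" and e: "\<And>t. \<bar>t - l\<bar> < e \<Longrightarrow> T t"
    using T unfolding eventually_nhds_metric dist_real_def by blast
  \<comment> \<open>The bound by \<open>\<bar>l\<bar>\<close> keeps \<open>lam\<close> away from the eigenvalue zero.\<close>
  define \<epsilon> where "\<epsilon> = min e \<bar>l\<bar>"
  have \<epsilon>: "\<epsilon> > 0" "\<epsilon> \<le> e" "\<epsilon> \<le> \<bar>l\<bar>" using \<open>e > 0\<close> l(1) by (auto simp: \<epsilon>_def)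
  obtain B where "open B" "ubar \<in> B" and B: "\<And>U. U \<in> B \<Longrightarrow> A U \<and> admissible P U \<and>
      \<bar>lam U - l\<bar> < \<epsilon> \<and> char_quartic P U (lam U) = 0"
    using eventually_conj[OF A near[OF \<epsilon>(1)]] unfolding eventually_nhds by blast
  have "genuinely_nonlinear (hns_matrix P) lam U" if U: "U \<in> B" for U
  proof -
    have T_near: "T t" if "t \<in> {l - \<epsilon><..<l + \<epsilon>}" for t
      by (rule e) (use that \<epsilon> in auto)
    have d: "(lam has_derivative (\<lambda>h. - F' (U, lam U) (h, 0) / F' (U, lam U) (0, 1))) (at U)"
    proof (rule implicit_root_has_derivative[OF \<open>open B\<close> U, where F = F and a = "l - \<epsilon>" and b = "l + \<epsilon>"])
      show "lam V \<in> {l - \<epsilon><..<l + \<epsilon>} \<and> F (V, lam V) = 0" if "V \<in> B" for V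
        using B[OF that] by (auto simp: F_def)
    qed (use AT B T_near in blast)+
    have lamU: "lam U \<noteq> 0" "admissible P U" "char_quartic P U (lam U) = 0"
      using B[OF U] \<epsilon> by auto
    have nz: "F' (U, lam U) (0, 1) \<noteq> 0" "F' (U, lam U) (eigendirection P U (lam U), 0) \<noteq> 0"
      using AT[of U "lam U"] B[OF U] T_near[of "lam U"] by (auto simp: abs_less_iff)
    show ?thesis
      unfolding genuinely_nonlinear_def
    proof (intro conjI allI impI)
      show "lam U \<in> eigenvalues (hns_matrix P U)"
        using eigenvalues_eq[OF P lamU(2)] lamU by simp
      show "lam differentiable at U" using d by (rule differentiableI)
      fix r assume "r \<noteq> 0 \<and> hns_matrix P U *v r = lam U *s r"
      then obtain c where c: "c \<noteq> 0" "r = c *s eigendirection P U (lam U)"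
        unfolding eigenvectors_iff[OF P lamU(2,1)] by blast
      have "F' (U, lam U) (r, 0) = c * F' (U, lam U) (eigendirection P U (lam U), 0)"
        using blinfun.scaleR_right[of "F' (U, lam U)" c "(eigendirection P U (lam U), 0)"]
        by (simp add: c(2) scalar_mult_eq_scaleR)
      then show "grad lam U \<bullet> r \<noteq> 0"
        unfolding grad_inner[OF d] using nz c(1) by simp
    qed
  qed
  then show ?thesis
    using \<open>open B\<close> \<open>ubar \<in> B\<close> unfolding eventually_nhds by blast
qed

theorem proposition4p1:
  fixes P :: hns_params
  assumes "positive_params P"
    and "1 < adiabatic P" and "adiabatic P \<le> 5 / 3"
  shows "(\<forall>z>0. \<forall>w>0. riemann_invariant (adiabatic P) w z < 0) \<and>
    (\<forall>\<^sub>F U in nhds ubar.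
       genuinely_nonlinear (hns_matrix P) (char_speed P 2) U \<and>
       genuinely_nonlinear (hns_matrix P) (char_speed P 4) U)"
proof (intro conjI allI impI eventually_conj)
  fix z w :: real assume "0 < z" "0 < w"
  then show "riemann_invariant (adiabatic P) w z < 0"
    using riemann_invariant_eq riemann_form_pos assms(2) by simp
next
  define s where "s = sqrt (Rgas P * calL (adiabatic P) (w_of P) (z_of P))"
  have pos: "Rgas P * calL (adiabatic P) (w_of P) (z_of P) > 0"
    using calL_pos params_eq[OF assms(1)] assms(1) by (simp add: positive_params_def)
  then have s: "s \<noteq> 0" "s\<^sup>2 = Rgas P * calL (adiabatic P) (w_of P) (z_of P)"
    unfolding s_def using real_sqrt_gt_zero[OF pos] real_sqrt_pow2[OF less_imp_le[OF pos]] by auto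
  note near = eventually_char_speeds_near[OF assms(1), folded s_def]
  show "\<forall>\<^sub>F U in nhds ubar. genuinely_nonlinear (hns_matrix P) (char_speed P 2) U"
    by (rule eventually_genuinely_nonlinear[OF assms(1), of "- s"])
       (use s in \<open>auto elim: eventually_mono[OF near]\<close>)
  show "\<forall>\<^sub>F U in nhds ubar. genuinely_nonlinear (hns_matrix P) (char_speed P 4) U"
    by (rule eventually_genuinely_nonlinear[OF assms(1), of s])
       (use s in \<open>auto elim: eventually_mono[OF near]\<close>)
qed

end
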